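(* Let $D$ be a multipartite tournament with a directed cycle, the sink elimination index $\zeta(D)\ge 1$, the sink sequence $(W_0,\ldots,W_{\zeta(D)})$, and the digraph sequence $(D_0,\ldots,D_{\zeta(D)})$ associated with the sink sequence. Then, for each vertex $w\in\bigcup_{i=0}^{\zeta(D)-1}W_i$, one of the following properties is true: (i) for every vertex $u$ in $D_{\zeta(D)}$, there is a $(u,w)$-directed walk of Type 1 in $D$; (ii) for every vertex $u$ in $D_{\zeta(D)}$, there is a $(u,w)$-directed walk of Type 2 in $D$.
   Context: All digraphs are finite, and the underlying graph of each digraph is simple (no loops, no multiple arcs, no directed cycles of length $2$). A multipartite tournament is an orientation of a complete $k$-partite graph (with $k$ nonempty partite sets) for some integer $k\ge 2$. A $(u,w)$-directed walk is a directed walk from $u$ to $w$. A directed hole in $D$ is a directed cycle of length at least $4$ in $D$ that is an induced subdigraph of $D$. A directed walk in $D$ is of Type 1 if it contains three vertices which induce a directed cycle of length $3$ in $D$, and of Type 2 if it contains four vertices which induce a directed hole of length $4$ in $D$ (a walk may be of both types). Sink sequence: a sink is a vertex of outdegree zero. Let $D_0=D$, and for each $i$ let $W_i$ be the set of sinks of $D_i$; if $W_i=V(D_i)$ or $W_i=\emptyset$, stop and put $\zeta(D)=i$; otherwise let $D_{i+1}=D_i-W_i$ (delete the vertices in $W_i$) and continue. The number $\zeta(D)$ is the sink elimination index of $D$, $(W_0,\ldots,W_{\zeta(D)})$ is the sink sequence of $D$, and $(D_0,\ldots,D_{\zeta(D)})$ is the digraph sequence associated with the sink sequence. *)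

theory Defs
  imports "Graph_Theory.Graph_Theory" "HOL-Library.Disjoint_Sets"
begin

text \<open>
  Digraphs are those of the locale \<^locale>\<open>digraph\<close> (finite, no loops, no parallel arcs).  The
  exclusive choice below also rules out directed cycles of length two.
\<close>

definition multipartite_tournament :: "('a, 'b) pre_digraph \<Rightarrow> bool" where
  "multipartite_tournament D \<longleftrightarrow>
     digraph D \<and>
     (\<exists>P. partition_on (verts D) P \<and> card P \<ge> 2 \<and>
        (\<forall>A\<in>P. \<forall>u\<in>A. \<forall>v\<in>A. \<not> u \<rightarrow>\<^bsub>D\<^esub> v) \<and>
        (\<forall>A\<in>P. \<forall>B\<in>P. A \<noteq> B \<longrightarrow> (\<forall>u\<in>A. \<forall>v\<in>B. (u \<rightarrow>\<^bsub>D\<^esub> v) \<noteq> (v \<rightarrow>\<^bsub>D\<^esub> u))))"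

text \<open>
  \<open>dicycle_digraph H n\<close>: the whole digraph \<open>H\<close> is a directed cycle of length \<open>n\<close>, with no further
  vertices or arcs.
\<close>

definition dicycle_digraph :: "('a, 'b) pre_digraph \<Rightarrow> nat \<Rightarrow> bool" where
  "dicycle_digraph H n \<longleftrightarrow>
     (\<exists>c. pre_digraph.cycle H c \<and> length c = n \<and> arcs H = set c \<and> verts H = tail H ` set c)"

definition directed_hole :: "('a, 'b) pre_digraph \<Rightarrow> ('a, 'b) pre_digraph \<Rightarrow> nat \<Rightarrow> bool" where
  "directed_hole D H n \<longleftrightarrow> n \<ge> 4 \<and> induced_subgraph H D \<and> dicycle_digraph H n"

definition type1_walk :: "('a, 'b) pre_digraph \<Rightarrow> 'a \<Rightarrow> 'b awalk \<Rightarrow> 'a \<Rightarrow> bool" where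
  "type1_walk D u p w \<longleftrightarrow>
     pre_digraph.awalk D u p w \<and>
     (\<exists>S \<subseteq> set (pre_digraph.awalk_verts D u p). card S = 3 \<and> dicycle_digraph (D \<restriction> S) 3)"

definition type2_walk :: "('a, 'b) pre_digraph \<Rightarrow> 'a \<Rightarrow> 'b awalk \<Rightarrow> 'a \<Rightarrow> bool" where
  "type2_walk D u p w \<longleftrightarrow>
     pre_digraph.awalk D u p w \<and>
     (\<exists>S \<subseteq> set (pre_digraph.awalk_verts D u p). card S = 4 \<and> directed_hole D (D \<restriction> S) 4)"

definition sinks :: "('a, 'b) pre_digraph \<Rightarrow> 'a set" where
  "sinks D = {v \<in> verts D. out_degree D v = 0}"

text \<open>
  The sequences are defined for all indices; only the terms up to \<open>sink_elim_index D\<close>, where the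
  elimination stops, are meaningful.  The lemmas at the end show that it does stop.
\<close>

primrec digraph_seq :: "('a, 'b) pre_digraph \<Rightarrow> nat \<Rightarrow> ('a, 'b) pre_digraph" where
  "digraph_seq D 0 = D"
| "digraph_seq D (Suc i) =
     digraph_seq D i \<restriction> (verts (digraph_seq D i) - sinks (digraph_seq D i))"

definition sink_seq :: "('a, 'b) pre_digraph \<Rightarrow> nat \<Rightarrow> 'a set" where
  "sink_seq D i = sinks (digraph_seq D i)"

definition elim_stops :: "('a, 'b) pre_digraph \<Rightarrow> nat \<Rightarrow> bool" where
  "elim_stops D i \<longleftrightarrow> sink_seq D i = verts (digraph_seq D i) \<or> sink_seq D i = {}"

definition sink_elim_index :: "('a, 'b) pre_digraph \<Rightarrow> nat" where
  "sink_elim_index D = (LEAST i. elim_stops D i)"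

lemma finite_verts_digraph_seq:
  assumes "finite (verts D)"
  shows "finite (verts (digraph_seq D i))"
  using assms by (induction i) auto

lemma elim_stops_exists:
  assumes "finite (verts D)"
  shows "\<exists>i. elim_stops D i"
proof (rule ccontr)
  assume no: "\<nexists>i. elim_stops D i"
  have less: "card (verts (digraph_seq D (Suc i))) < card (verts (digraph_seq D i))" for i
  proof (rule psubset_card_mono[OF finite_verts_digraph_seq[OF assms]])
    have "sink_seq D i \<noteq> {}" "sink_seq D i \<subseteq> verts (digraph_seq D i)"
      using no by (auto simp: elim_stops_def sink_seq_def sinks_def)
    then show "verts (digraph_seq D (Suc i)) \<subset> verts (digraph_seq D i)"
      by (auto simp: sink_seq_def)
  qed
  have "card (verts (digraph_seq D i)) + i \<le> card (verts D)" for i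
  proof (induction i)
    case (Suc i)
    then show ?case using less[of i] by linarith
  qed simp
  from this[of "Suc (card (verts D))"] show False by simp
qed

lemma elim_stops_sink_elim_index:
  assumes "finite (verts D)"
  shows "elim_stops D (sink_elim_index D)"
  unfolding sink_elim_index_def using elim_stops_exists[OF assms] by (rule LeastI_ex)

end

theory Submission
  imports Defs
begin

text \<open>
  Let \<open>X\<close> be the vertex set of the last digraph of the sequence.  It is nonempty and has no sinks, so
  it contains a terminal strong component with at least one arc.  As nonadjacency is an equivalence
  relation, every vertex is adjacent to one of the two ends of that arc; therefore the component is
  reachable from all of \<open>X\<close>.  A shortest directed cycle in it has length \<open>3\<close>, or length \<open>4\<close> and no
  chord, and every vertex \<open>w\<close> eliminated before is dominated by one of two consecutive vertices of
  this cycle, since no arc leads from \<open>w\<close> to \<open>X\<close>.  The cycle does not depend on the vertex \<open>u\<close>,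
  hence neither does the type of the walk.
\<close>

section \<open>Relations in which every point is comparable to an end of every edge\<close>

text \<open>Choose \<open>t\<close> with the fewest reachable points. Whatever \<open>t\<close>
  reaches has a reachable set contained in that of \<open>t\<close>, hence equal to it by
  minimality, hence containing \<open>t\<close>.\<close>

lemma finite_rel_terminal:
  assumes "finite V" "V \<noteq> {}" "E \<subseteq> V \<times> V"
  shows "\<exists>t\<in>V. \<forall>v. (t, v) \<in> E\<^sup>* \<longrightarrow> (v, t) \<in> E\<^sup>*"
proof -
  have sub: "E\<^sup>* `` {t} \<subseteq> V" if "t \<in> V" for t
    using assms(3) that by (auto elim: rtranclE)
  define t where "t = arg_min_on (\<lambda>t. card (E\<^sup>* `` {t})) V"
  have t: "t \<in> V"
    unfolding t_def by (rule arg_min_if_finite(1)[OF assms(1,2)])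
  have min: "card (E\<^sup>* `` {t}) \<le> card (E\<^sup>* `` {v})" if "v \<in> V" for v
    unfolding t_def by (rule arg_min_least[OF assms(1,2) that])
  have "(v, t) \<in> E\<^sup>*" if tv: "(t, v) \<in> E\<^sup>*" for v
  proof -
    have "v \<in> V" using sub[OF t] tv by blast
    have "E\<^sup>* `` {v} \<subseteq> E\<^sup>* `` {t}" using tv by (auto intro: rtrancl_trans)
    moreover have "finite (E\<^sup>* `` {t})" using sub[OF t] assms(1) finite_subset by blast
    ultimately have "E\<^sup>* `` {v} = E\<^sup>* `` {t}"
      using min[OF \<open>v \<in> V\<close>] card_seteq by blast
    then show ?thesis by blast
  qed
  then show ?thesis using t by blast
qed

text \<open>This is transitivity of nonadjacency in contrapositive form: a point nonadjacent to both
  ends of an edge would put these ends in one partite set. Unlike a partition, it passes to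
  restrictions without bookkeeping.\<close>

definition comparable_to_edges :: "'a rel \<Rightarrow> bool" where
  "comparable_to_edges E \<longleftrightarrow> (\<forall>x y z. (x, y) \<in> E \<and> z \<in> Field E \<longrightarrow>
     (x, z) \<in> E \<or> (z, x) \<in> E \<or> (y, z) \<in> E \<or> (z, y) \<in> E)"

lemma comparable_to_edgesD:
  "comparable_to_edges E \<Longrightarrow> (x, y) \<in> E \<Longrightarrow> z \<in> Field E \<Longrightarrow>
     (x, z) \<in> E \<or> (z, x) \<in> E \<or> (y, z) \<in> E \<or> (z, y) \<in> E"
  by (auto simp: comparable_to_edges_def)

definition triangle_at :: "'a rel \<Rightarrow> 'a \<Rightarrow> bool" where
  "triangle_at E y \<longleftrightarrow> (\<exists>a b. (y, a) \<in> E \<and> (a, b) \<in> E \<and> (b, y) \<in> E)"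

definition square_at :: "'a rel \<Rightarrow> 'a \<Rightarrow> bool" where
  "square_at E y \<longleftrightarrow> (\<exists>a b c. (y, a) \<in> E \<and> (a, b) \<in> E \<and> (b, c) \<in> E \<and> (c, y) \<in> E \<and>
     (y, b) \<notin> E \<and> (b, y) \<notin> E \<and> (a, c) \<notin> E \<and> (c, a) \<notin> E)"

text \<open>Strong induction on the length of a closed walk x, a, b, c, ..., x. An edge from x to b
  or to c shortens the walk, and an edge from b to x closes a triangle. Otherwise c has an edge to
  x, and the diagonal between a and c decides between a triangle and a square. The walk may repeat
  vertices.\<close>

lemma closed_walk_short_cycle:
  assumes "asym E" "comparable_to_edges E" "(x, x) \<in> E ^^ n" "n > 0"
  shows "\<exists>y. (x, y) \<in> E\<^sup>* \<and> (triangle_at E y \<or> square_at E y)"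
  using assms(3,4)
proof (induction n rule: less_induct)
  case (less n)
  have asym: "(v, u) \<notin> E" if "(u, v) \<in> E" for u v
    using that assms(1) by (auto dest: asymD)
  \<comment> \<open>Asymmetry excludes loops and pairs of opposite edges, so the walk has at least
    three edges.\<close>
  have "n \<noteq> 1" using less.prems asym[of x x] by auto
  moreover have "n \<noteq> 2" using less.prems asym by (auto simp: numeral_2_eq_2)
  ultimately obtain m where n: "n = m + 3"
    using less.prems(2) le_Suc_ex[of 3 n] by (auto simp: add.commute)
  have "(x, x) \<in> E ^^ Suc (Suc (Suc m))" using less.prems(1) n by (simp add: numeral_3_eq_3)
  then obtain a b c where xa: "(x, a) \<in> E" and ab: "(a, b) \<in> E" and bc: "(b, c) \<in> E"
    and cx: "(c, x) \<in> E ^^ m"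
    by (meson relpow_Suc_E2)
  have bx: "(b, x) \<in> E ^^ Suc m" using bc cx by (rule relpow_Suc_I2)
  show ?case
  proof (cases "m = 0")
    case True
    then have "triangle_at E x" using xa ab bc cx by (auto simp: triangle_at_def)
    then show ?thesis by blast
  next
    case False
    consider "(b, x) \<in> E" | "(x, b) \<in> E" | "(x, b) \<notin> E" "(b, x) \<notin> E" by blast
    then show ?thesis
    proof cases
      case 1
      then have "triangle_at E x" using xa ab by (auto simp: triangle_at_def)
      then show ?thesis by blast
    next
      case 2
      then have "(x, x) \<in> E ^^ Suc (Suc m)" using bx by (rule relpow_Suc_I2)
      from less.IH[OF _ this] n show ?thesis by simp
    next
      case 3
      have "x \<in> Field E" using xa by (auto simp: Field_def)
      then consider "(c, x) \<in> E" | "(x, c) \<in> E"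
        using comparable_to_edgesD[OF assms(2) bc, of x] 3 by blast
      then show ?thesis
      proof cases
        case 2
        then have "(x, x) \<in> E ^^ Suc m" using cx by (rule relpow_Suc_I2)
        from less.IH[OF _ this] n show ?thesis by simp
      next
        case 1
        consider "(a, c) \<in> E" | "(c, a) \<in> E" | "(a, c) \<notin> E" "(c, a) \<notin> E" by blast
        then show ?thesis
        proof cases
          case 1
          then have "triangle_at E x" using xa \<open>(c, x) \<in> E\<close> by (auto simp: triangle_at_def)
          then show ?thesis by blast
        next
          \<comment> \<open>This triangle avoids \<open>x\<close>, which is why the conclusion
            speaks of a point reachable from \<open>x\<close>.\<close>
          case 2
          then have "triangle_at E a" using ab bc by (auto simp: triangle_at_def)
          then show ?thesis using xa by blast
        next
          case 3
          then have "square_at E x"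
            using xa ab bc \<open>(c, x) \<in> E\<close> \<open>(x, b) \<notin> E\<close> \<open>(b, x) \<notin> E\<close>
            unfolding square_at_def by blast
          then show ?thesis by blast
        qed
      qed
    qed
  qed
qed

text \<open>Take an edge from a terminal point \<open>t\<close> to \<open>t'\<close>. Every
  \<open>u\<close> is adjacent to one of these two; if the edge points to \<open>u\<close>,
  terminality leads back to \<open>t\<close>, and otherwise \<open>u\<close> reaches
  \<open>t\<close> directly or through \<open>t'\<close>. The edge also lies on a closed walk
  through \<open>t\<close>, which yields the short cycle.\<close>

lemma short_cycle_reachable_from_all:
  assumes "finite V" "V \<noteq> {}" "E \<subseteq> V \<times> V" "asym E" "comparable_to_edges E"
    and no_sink: "\<And>v. v \<in> V \<Longrightarrow> \<exists>v'. (v, v') \<in> E"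
  shows "\<exists>y. (triangle_at E y \<or> square_at E y) \<and> (\<forall>u\<in>V. (u, y) \<in> E\<^sup>*)"
proof -
  obtain t where t: "t \<in> V" "\<And>v. (t, v) \<in> E\<^sup>* \<Longrightarrow> (v, t) \<in> E\<^sup>*"
    using finite_rel_terminal[OF assms(1-3)] by blast
  obtain t' where tt': "(t, t') \<in> E" using no_sink[OF t(1)] by blast
  then have t't: "(t', t) \<in> E\<^sup>*" using t(2) by blast
  have ut: "(u, t) \<in> E\<^sup>*" if u: "u \<in> V" for u
  proof -
    have "u \<in> Field E" using no_sink[OF u] by (auto simp: Field_def)
    then consider "(t, u) \<in> E" | "(u, t) \<in> E" | "(t', u) \<in> E" | "(u, t') \<in> E"
      using comparable_to_edgesD[OF assms(5) tt'] by blast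
    then show ?thesis
    proof cases
      case 3
      then have "(t, u) \<in> E\<^sup>*" using tt' by (meson r_into_rtrancl rtrancl_into_rtrancl)
      then show ?thesis by (rule t(2))
    next
      case 4
      then show ?thesis using t't by (rule converse_rtrancl_into_rtrancl)
    qed (use t(2) in auto)
  qed
  obtain n where "(t', t) \<in> E ^^ n" using t't by (auto dest: rtrancl_imp_relpow)
  then have "(t, t) \<in> E ^^ Suc n" using tt' by (meson relpow_Suc_I2)
  then obtain y where "(t, y) \<in> E\<^sup>*" "triangle_at E y \<or> square_at E y"
    using closed_walk_short_cycle[OF assms(4,5)] by blast
  then show ?thesis using ut by (meson rtrancl_trans)
qed

section \<open>Short cycles and walks in multipartite tournaments\<close>

lemma multipartite_tournament_asym:
  assumes "multipartite_tournament D" "u \<rightarrow>\<^bsub>D\<^esub> v"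
  shows "\<not> v \<rightarrow>\<^bsub>D\<^esub> u"
proof -
  obtain P where P: "partition_on (verts D) P" "\<forall>A\<in>P. \<forall>u\<in>A. \<forall>v\<in>A. \<not> u \<rightarrow>\<^bsub>D\<^esub> v"
    "\<forall>A\<in>P. \<forall>B\<in>P. A \<noteq> B \<longrightarrow> (\<forall>u\<in>A. \<forall>v\<in>B. (u \<rightarrow>\<^bsub>D\<^esub> v) \<noteq> (v \<rightarrow>\<^bsub>D\<^esub> u))"
    and "digraph D" using assms(1) unfolding multipartite_tournament_def by blast
  interpret digraph D by fact
  have "u \<in> verts D" "v \<in> verts D" using assms(2) by auto
  then obtain A B where "A \<in> P" "B \<in> P" "u \<in> A" "v \<in> B"
    using partition_onD1[OF P(1)] by blast
  then show ?thesis using P(2,3) assms(2) by blast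
qed

text \<open>The ends of an arc lie in different partite sets, so the set containing \<open>z\<close>
  differs from at least one of them.\<close>

lemma multipartite_tournament_comparable:
  assumes "multipartite_tournament D" "x \<rightarrow>\<^bsub>D\<^esub> y" "z \<in> verts D"
  shows "x \<rightarrow>\<^bsub>D\<^esub> z \<or> z \<rightarrow>\<^bsub>D\<^esub> x \<or> y \<rightarrow>\<^bsub>D\<^esub> z \<or> z \<rightarrow>\<^bsub>D\<^esub> y"
proof -
  obtain P where P: "partition_on (verts D) P" "\<forall>A\<in>P. \<forall>u\<in>A. \<forall>v\<in>A. \<not> u \<rightarrow>\<^bsub>D\<^esub> v"
    "\<forall>A\<in>P. \<forall>B\<in>P. A \<noteq> B \<longrightarrow> (\<forall>u\<in>A. \<forall>v\<in>B. (u \<rightarrow>\<^bsub>D\<^esub> v) \<noteq> (v \<rightarrow>\<^bsub>D\<^esub> u))"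
    and "digraph D" using assms(1) unfolding multipartite_tournament_def by blast
  interpret digraph D by fact
  have "x \<in> verts D" "y \<in> verts D" using assms(2) by auto
  then obtain A B C where ABC: "A \<in> P" "B \<in> P" "C \<in> P" "x \<in> A" "y \<in> B" "z \<in> C"
    using partition_onD1[OF P(1)] assms(3) by blast
  have "C \<noteq> A \<or> C \<noteq> B" using P(2) assms(2) ABC by blast
  then show ?thesis using P(3) ABC by metis
qed

lemma dominatesE:
  assumes "u \<rightarrow>\<^bsub>D\<^esub> v"
  obtains e where "e \<in> arcs D" "tail D e = u" "head D e = v"
  using assms by (auto simp: arcs_ends_def arc_to_ends_def)

lemma arc_dominates: "e \<in> arcs D \<Longrightarrow> tail D e \<rightarrow>\<^bsub>D\<^esub> head D e"
  by (auto simp: arcs_ends_def arc_to_ends_def)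

text \<open>The induced subdigraph must have no arcs beyond the cycle: asymmetry rules out loops and
  reversed arcs, and the absence of parallel arcs makes each of the three arcs unique.\<close>

lemma triangle_dicycle_digraph:
  assumes "multipartite_tournament D" "y \<rightarrow>\<^bsub>D\<^esub> a" "a \<rightarrow>\<^bsub>D\<^esub> b" "b \<rightarrow>\<^bsub>D\<^esub> y"
  shows "card {y, a, b} = 3" "dicycle_digraph (D \<restriction> {y, a, b}) 3"
proof -
  note asym = multipartite_tournament_asym[OF assms(1)]
  have "digraph D" using assms(1) by (simp add: multipartite_tournament_def)
  then interpret digraph D .
  have no_arcs: "\<not> a \<rightarrow>\<^bsub>D\<^esub> y" "\<not> b \<rightarrow>\<^bsub>D\<^esub> a" "\<not> y \<rightarrow>\<^bsub>D\<^esub> b" "\<And>x. \<not> x \<rightarrow>\<^bsub>D\<^esub> x"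
    using assms(2-4) asym by blast+
  then have ne: "y \<noteq> a" "a \<noteq> b" "b \<noteq> y" using assms(2-4) by auto
  then show "card {y, a, b} = 3" by auto
  obtain e1 where e1: "e1 \<in> arcs D" "tail D e1 = y" "head D e1 = a" using assms(2) by (rule dominatesE)
  obtain e2 where e2: "e2 \<in> arcs D" "tail D e2 = a" "head D e2 = b" using assms(3) by (rule dominatesE)
  obtain e3 where e3: "e3 \<in> arcs D" "tail D e3 = b" "head D e3 = y" using assms(4) by (rule dominatesE)
  have "e \<in> {e1, e2, e3}" if "e \<in> arcs D" "tail D e \<in> {y, a, b}" "head D e \<in> {y, a, b}" for e
  proof -
    have "(tail D e, head D e) \<in> {(y, a), (a, b), (b, y)}"
      using that(2,3) arc_dominates[OF that(1)] no_arcs by auto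
    then show ?thesis
      using no_multi_arcs[OF that(1), unfolded arc_to_ends_def] e1 e2 e3 by auto
  qed
  then have arcs: "arcs (D \<restriction> {y, a, b}) = {e1, e2, e3}" using e1 e2 e3 by auto
  have "pre_digraph.cycle (D \<restriction> {y, a, b}) [e1, e2, e3]"
    unfolding pre_digraph.cycle_def pre_digraph.awalk_def arcs
    using e1 e2 e3 ne by (intro exI[of _ y]) (auto simp: pre_digraph.cas.simps pre_digraph.awalk_verts.simps)
  then show "dicycle_digraph (D \<restriction> {y, a, b}) 3"
    unfolding dicycle_digraph_def arcs using e1 e2 e3 by (intro exI[of _ "[e1, e2, e3]"]) auto
qed

lemma square_directed_hole:
  assumes "multipartite_tournament D" "y \<rightarrow>\<^bsub>D\<^esub> a" "a \<rightarrow>\<^bsub>D\<^esub> b" "b \<rightarrow>\<^bsub>D\<^esub> c" "c \<rightarrow>\<^bsub>D\<^esub> y"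
    and nonadj: "\<not> y \<rightarrow>\<^bsub>D\<^esub> b" "\<not> b \<rightarrow>\<^bsub>D\<^esub> y" "\<not> a \<rightarrow>\<^bsub>D\<^esub> c" "\<not> c \<rightarrow>\<^bsub>D\<^esub> a"
  shows "card {y, a, b, c} = 4" "directed_hole D (D \<restriction> {y, a, b, c}) 4"
proof -
  note asym = multipartite_tournament_asym[OF assms(1)]
  have "digraph D" using assms(1) by (simp add: multipartite_tournament_def)
  then interpret digraph D .
  have no_arcs: "\<not> a \<rightarrow>\<^bsub>D\<^esub> y" "\<not> b \<rightarrow>\<^bsub>D\<^esub> a" "\<not> c \<rightarrow>\<^bsub>D\<^esub> b" "\<not> y \<rightarrow>\<^bsub>D\<^esub> c" "\<And>x. \<not> x \<rightarrow>\<^bsub>D\<^esub> x"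
    using assms(2-5) asym by blast+
  \<comment> \<open>No arc separates opposite vertices, but their neighbours do: \<open>c\<close> is
    dominated by \<open>b\<close> and not by \<open>y\<close>, and \<open>y\<close> dominates
    \<open>a\<close> and not \<open>c\<close>.\<close>
  then have ne: "y \<noteq> a" "y \<noteq> b" "y \<noteq> c" "a \<noteq> b" "a \<noteq> c" "b \<noteq> c"
    using assms(2-) by auto
  then show "card {y, a, b, c} = 4" by auto
  obtain e1 where e1: "e1 \<in> arcs D" "tail D e1 = y" "head D e1 = a" using assms(2) by (rule dominatesE)
  obtain e2 where e2: "e2 \<in> arcs D" "tail D e2 = a" "head D e2 = b" using assms(3) by (rule dominatesE)
  obtain e3 where e3: "e3 \<in> arcs D" "tail D e3 = b" "head D e3 = c" using assms(4) by (rule dominatesE)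
  obtain e4 where e4: "e4 \<in> arcs D" "tail D e4 = c" "head D e4 = y" using assms(5) by (rule dominatesE)
  have "e \<in> {e1, e2, e3, e4}"
    if "e \<in> arcs D" "tail D e \<in> {y, a, b, c}" "head D e \<in> {y, a, b, c}" for e
  proof -
    have "(tail D e, head D e) \<in> {(y, a), (a, b), (b, c), (c, y)}"
      using that(2,3) arc_dominates[OF that(1)] no_arcs nonadj by auto
    then show ?thesis
      using no_multi_arcs[OF that(1), unfolded arc_to_ends_def] e1 e2 e3 e4 by auto
  qed
  then have arcs: "arcs (D \<restriction> {y, a, b, c}) = {e1, e2, e3, e4}" using e1 e2 e3 e4 by auto
  have "pre_digraph.cycle (D \<restriction> {y, a, b, c}) [e1, e2, e3, e4]"
    unfolding pre_digraph.cycle_def pre_digraph.awalk_def arcs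
    using e1 e2 e3 e4 ne
    by (intro exI[of _ y]) (auto simp: pre_digraph.cas.simps pre_digraph.awalk_verts.simps)
  then have "dicycle_digraph (D \<restriction> {y, a, b, c}) 4"
    unfolding dicycle_digraph_def arcs using e1 e2 e3 e4
    by (intro exI[of _ "[e1, e2, e3, e4]"]) auto
  moreover have "induced_subgraph (D \<restriction> {y, a, b, c}) D"
    using e1 e2 e3 e4 by (intro induced_induce) auto
  ultimately show "directed_hole D (D \<restriction> {y, a, b, c}) 4"
    by (simp add: directed_hole_def)
qed

section \<open>Walks visiting prescribed vertices\<close>

context wf_digraph
begin

text \<open>Walks are built backwards from their end \<open>w\<close>, with \<open>S\<close>
  recording vertices already visited. The existential premise has the shape of the conclusion, so
  that applications can be nested.\<close>

lemma awalk_visiting_Cons: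
  assumes "u \<rightarrow>\<^bsub>G\<^esub> v" "\<exists>p. awalk v p w \<and> S \<subseteq> set (awalk_verts v p)"
  shows "\<exists>p. awalk u p w \<and> insert u S \<subseteq> set (awalk_verts u p)"
proof -
  obtain e where e: "e \<in> arcs G" "tail G e = u" "head G e = v"
    using assms(1) by (rule dominatesE)
  obtain p where "awalk v p w" "S \<subseteq> set (awalk_verts v p)" using assms(2) by blast
  then have "awalk u (e # p) w \<and> insert u S \<subseteq> set (awalk_verts u (e # p))"
    using e by (auto simp: awalk_Cons_iff)
  then show ?thesis by blast
qed

lemma awalk_visiting_rtrancl:
  assumes "(u, v) \<in> (arcs_ends G)\<^sup>*" "\<exists>p. awalk v p w \<and> S \<subseteq> set (awalk_verts v p)"
  shows "\<exists>p. awalk u p w \<and> S \<subseteq> set (awalk_verts u p)"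
  using assms(1)
proof (induction rule: converse_rtrancl_induct)
  case base
  then show ?case by (rule assms(2))
next
  case (step u u')
  then show ?case using awalk_visiting_Cons by (meson insert_subset)
qed

lemma awalk_visiting_Nil:
  assumes "w \<in> verts G"
  shows "\<exists>p. awalk w p w \<and> {} \<subseteq> set (awalk_verts w p)"
  using assms by (intro exI[of _ "[]"]) (simp add: awalk_Nil_iff)

end

text \<open>Go from \<open>u\<close> to \<open>y\<close>, once around the triangle back to
  \<open>y\<close>, and then to \<open>w\<close>, either directly or through \<open>a\<close>. The
  full turn ensures that all three vertices are visited in both cases.\<close>

lemma type1_walk_via_triangle:
  assumes D: "multipartite_tournament D"
    and cyc: "y \<rightarrow>\<^bsub>D\<^esub> a" "a \<rightarrow>\<^bsub>D\<^esub> b" "b \<rightarrow>\<^bsub>D\<^esub> y"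
    and uy: "(u, y) \<in> (arcs_ends D)\<^sup>*" and w: "y \<rightarrow>\<^bsub>D\<^esub> w \<or> a \<rightarrow>\<^bsub>D\<^esub> w"
  shows "\<exists>p. type1_walk D u p w"
proof -
  have "digraph D" using D by (simp add: multipartite_tournament_def)
  then interpret digraph D .
  note Cons = awalk_visiting_Cons
  have "w \<in> verts D" using w by auto
  note Nil = awalk_visiting_Nil[OF this]
  have "\<exists>p. awalk y p w"
    using w Cons[OF _ Nil] Cons[OF cyc(1) Cons[OF _ Nil]] by blast
  \<comment> \<open>The record of visited vertices restarts from the empty set, since the turn
    around the triangle supplies all of them.\<close>
  then have "\<exists>p. awalk y p w \<and> {} \<subseteq> set (awalk_verts y p)" by blast
  from Cons[OF cyc(1) Cons[OF cyc(2) Cons[OF cyc(3) this]]]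
  obtain p where "awalk u p w" "{y, a, b} \<subseteq> set (awalk_verts u p)"
    using awalk_visiting_rtrancl[OF uy] by blast
  then show ?thesis
    using triangle_dicycle_digraph[OF D cyc] unfolding type1_walk_def by blast
qed

lemma type2_walk_via_square:
  assumes D: "multipartite_tournament D"
    and cyc: "y \<rightarrow>\<^bsub>D\<^esub> a" "a \<rightarrow>\<^bsub>D\<^esub> b" "b \<rightarrow>\<^bsub>D\<^esub> c" "c \<rightarrow>\<^bsub>D\<^esub> y"
    and nonadj: "\<not> y \<rightarrow>\<^bsub>D\<^esub> b" "\<not> b \<rightarrow>\<^bsub>D\<^esub> y" "\<not> a \<rightarrow>\<^bsub>D\<^esub> c" "\<not> c \<rightarrow>\<^bsub>D\<^esub> a"
    and uy: "(u, y) \<in> (arcs_ends D)\<^sup>*" and w: "y \<rightarrow>\<^bsub>D\<^esub> w \<or> a \<rightarrow>\<^bsub>D\<^esub> w"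
  shows "\<exists>p. type2_walk D u p w"
proof -
  have "digraph D" using D by (simp add: multipartite_tournament_def)
  then interpret digraph D .
  note Cons = awalk_visiting_Cons
  have "w \<in> verts D" using w by auto
  note Nil = awalk_visiting_Nil[OF this]
  have "\<exists>p. awalk y p w"
    using w Cons[OF _ Nil] Cons[OF cyc(1) Cons[OF _ Nil]] by blast
  then have "\<exists>p. awalk y p w \<and> {} \<subseteq> set (awalk_verts y p)" by blast
  from Cons[OF cyc(1) Cons[OF cyc(2) Cons[OF cyc(3) Cons[OF cyc(4) this]]]]
  obtain p where "awalk u p w" "{y, a, b, c} \<subseteq> set (awalk_verts u p)"
    using awalk_visiting_rtrancl[OF uy] by blast
  then show ?thesis
    using square_directed_hole[OF D cyc nonadj] unfolding type2_walk_def by blast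
qed

section \<open>The sink sequence\<close>

lemma tail_digraph_seq [simp]: "tail (digraph_seq D i) = tail D"
  by (induction i) auto

lemma head_digraph_seq [simp]: "head (digraph_seq D i) = head D"
  by (induction i) auto

lemma verts_digraph_seq_antimono:
  "i \<le> j \<Longrightarrow> verts (digraph_seq D j) \<subseteq> verts (digraph_seq D i)"
  by (induction rule: dec_induct) auto

text \<open>Every term of the sequence is induced in \<open>D\<close> itself, because the vertex
  sets decrease along the repeated restrictions.\<close>

lemma arcs_digraph_seq:
  assumes "wf_digraph D"
  shows "arcs (digraph_seq D i) =
    {e \<in> arcs D. tail D e \<in> verts (digraph_seq D i) \<and> head D e \<in> verts (digraph_seq D i)}"
proof (induction i)
  case 0
  then show ?case using assms by (auto simp: wf_digraph_def)
qed auto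

lemma sink_seq_iff:
  assumes "fin_digraph D"
  shows "v \<in> sink_seq D i \<longleftrightarrow> v \<in> verts (digraph_seq D i) \<and>
    (\<forall>x \<in> verts (digraph_seq D i). \<not> v \<rightarrow>\<^bsub>D\<^esub> x)"
proof -
  interpret fin_digraph D by fact
  have arcs: "arcs (digraph_seq D i) =
    {e \<in> arcs D. tail D e \<in> verts (digraph_seq D i) \<and> head D e \<in> verts (digraph_seq D i)}"
    by (rule arcs_digraph_seq) unfold_locales
  \<comment> \<open>The out-degree is a cardinality, and \<open>card\<close> is 0 on infinite sets
    as well; finiteness is what turns degree 0 into the absence of arcs.\<close>
  have "finite (out_arcs (digraph_seq D i) v)"
    by (rule finite_subset[of _ "arcs D"]) (auto simp: arcs)
  then have "out_degree (digraph_seq D i) v = 0 \<longleftrightarrow> out_arcs (digraph_seq D i) v = {}"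
    by (simp add: out_degree_def)
  also have "\<dots> \<longleftrightarrow> (\<forall>x \<in> verts (digraph_seq D i). \<not> v \<rightarrow>\<^bsub>D\<^esub> x)"
    if "v \<in> verts (digraph_seq D i)"
    using that by (auto simp: out_arcs_def arcs elim!: dominatesE dest: arc_dominates)
  finally show ?thesis by (auto simp: sink_seq_def sinks_def)
qed

text \<open>While the whole cycle is present, each of its vertices has its successor as an
  out-neighbour and is not a sink. This holds for every index, including those past the end of the
  elimination.\<close>

lemma cycle_verts_digraph_seq:
  assumes "fin_digraph D" "pre_digraph.cycle D c"
  shows "tail D ` set c \<subseteq> verts (digraph_seq D i)"
proof (induction i)
  interpret fin_digraph D by fact
  case 0
  then show ?case using assms(2) by (auto simp: cycle_def awalk_def)
next
  interpret fin_digraph D by fact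
  obtain u where u: "awalk u c u" "c \<noteq> []" using assms(2) by (auto simp: cycle_def)
  \<comment> \<open>The vertices of the walk are the tails of its arcs together with the last vertex
    \<open>u\<close>, which is also the tail of the first arc because the walk is closed.\<close>
  have "head D e \<in> tail D ` set c" if "e \<in> set c" for e
  proof -
    have "head D e \<in> set (awalk_verts u c)"
      using that u by (auto simp: set_awalk_verts)
    moreover have "u \<in> tail D ` set c"
      using u by (cases c) (auto simp: awalk_Cons_iff)
    moreover have "set (awalk_verts u c) = set (map (tail D) c @ [u])"
      using u awlast_of_awalk[OF u(1)] by (simp add: awalk_verts_conv)
    ultimately show ?thesis by auto
  qed
  moreover have "set c \<subseteq> arcs D" using u by auto
  moreover case (Suc i)
  ultimately have "\<not> tail D e \<in> sink_seq D i" if "e \<in> set c" for e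
    using that arc_dominates[of e D] sink_seq_iff[OF assms(1), of "tail D e" i] by blast
  then show ?case using Suc by (auto simp: sink_seq_def)
qed

section \<open>The short cycle in the last digraph and the walks through it\<close>

theorem theorem3p8:
  fixes D :: "('a, 'b) pre_digraph"
  assumes "multipartite_tournament D"
    and "\<exists>c. pre_digraph.cycle D c"
    and "sink_elim_index D \<ge> 1"
  shows "\<forall>w \<in> (\<Union>i<sink_elim_index D. sink_seq D i).
           (\<forall>u \<in> verts (digraph_seq D (sink_elim_index D)). \<exists>p. type1_walk D u p w) \<or>
           (\<forall>u \<in> verts (digraph_seq D (sink_elim_index D)). \<exists>p. type2_walk D u p w)"
proof
  have "digraph D" using assms(1) by (simp add: multipartite_tournament_def)
  then interpret digraph D .
  have fin: "fin_digraph D" by unfold_locales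
  define k where "k = sink_elim_index D"
  define X where "X = verts (digraph_seq D k)"
  define E where "E = arcs_ends D \<inter> X \<times> X"
  have XD: "X \<subseteq> verts D"
    using verts_digraph_seq_antimono[of 0 k D] by (simp add: X_def)
  have "finite X" using XD finite_verts finite_subset by blast
  obtain c where c: "cycle c" using assms(2) by blast
  then obtain e c' where ec: "c = e # c'" by (cases c) (auto simp: cycle_def)
  have cX: "tail D ` set c \<subseteq> X"
    using cycle_verts_digraph_seq[OF fin c] by (simp add: X_def)
  then have "X \<noteq> {}" using ec by auto
  \<comment> \<open>One step past the stopping index: if all vertices of the last digraph were
    sinks, the next one would be empty, yet the cycle survives in it. So the elimination stopped for
    lack of sinks.\<close>
  have "tail D e \<in> verts (digraph_seq D (Suc k))"
    using cycle_verts_digraph_seq[OF fin c, of "Suc k"] ec by auto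
  then have "sink_seq D k \<noteq> X" by (auto simp: sink_seq_def X_def)
  then have "sink_seq D k = {}"
    using elim_stops_sink_elim_index[OF finite_verts] by (simp add: elim_stops_def k_def X_def)
  then have no_sink: "\<exists>v'. (v, v') \<in> E" if "v \<in> X" for v
    using that sink_seq_iff[OF fin, of v k] by (auto simp: E_def X_def)
  have "asym E"
    using multipartite_tournament_asym[OF assms(1)] by (auto simp: E_def intro: asymI)
  moreover have "comparable_to_edges E"
    unfolding comparable_to_edges_def
  proof (intro allI impI, elim conjE)
    fix x y z assume xy: "(x, y) \<in> E" and "z \<in> Field E"
    then have "z \<in> X" by (auto simp: E_def Field_def)
    then show "(x, z) \<in> E \<or> (z, x) \<in> E \<or> (y, z) \<in> E \<or> (z, y) \<in> E"
      using multipartite_tournament_comparable[OF assms(1), of x y z] xy XD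
      by (auto simp: E_def)
  qed
  ultimately obtain y where y: "triangle_at E y \<or> square_at E y"
    and reach: "\<And>u. u \<in> X \<Longrightarrow> (u, y) \<in> E\<^sup>*"
    using short_cycle_reachable_from_all[OF \<open>finite X\<close> \<open>X \<noteq> {}\<close> _ _ _ no_sink]
    by (auto simp: E_def)
  have uy: "(u, y) \<in> (arcs_ends D)\<^sup>*" if "u \<in> X" for u
    using reach[OF that] rtrancl_mono[of E "arcs_ends D"] by (auto simp: E_def)
  fix w assume "w \<in> (\<Union>i<sink_elim_index D. sink_seq D i)"
  then obtain i where i: "i < k" "w \<in> sink_seq D i" by (auto simp: k_def)
  have w: "w \<in> verts D"
    using i sink_seq_iff[OF fin, of w i] verts_digraph_seq_antimono[of 0 i D] by auto
  \<comment> \<open>\<open>w\<close> is a sink of an earlier digraph of the sequence, whose vertex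
    set contains \<open>X\<close>.\<close>
  have wX: "\<not> w \<rightarrow>\<^bsub>D\<^esub> x" if "x \<in> X" for x
    using i sink_seq_iff[OF fin, of w i] verts_digraph_seq_antimono[of i k D] that
    by (auto simp: X_def)
  have dom: "x \<rightarrow>\<^bsub>D\<^esub> w \<or> x' \<rightarrow>\<^bsub>D\<^esub> w" if "(x, x') \<in> E" for x x'
    using multipartite_tournament_comparable[OF assms(1), of x x' w] that w wX
    by (auto simp: E_def)
  from y have "(\<forall>u\<in>X. \<exists>p. type1_walk D u p w) \<or> (\<forall>u\<in>X. \<exists>p. type2_walk D u p w)"
  proof
    assume "triangle_at E y"
    then obtain a b where ab: "(y, a) \<in> E" "(a, b) \<in> E" "(b, y) \<in> E"
      by (auto simp: triangle_at_def)
    then have "\<exists>p. type1_walk D u p w" if "u \<in> X" for u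
      using type1_walk_via_triangle[OF assms(1) _ _ _ uy[OF that] dom[OF ab(1)]]
      by (auto simp: E_def)
    then show ?thesis by blast
  next
    assume "square_at E y"
    then obtain a b c where abc: "(y, a) \<in> E" "(a, b) \<in> E" "(b, c) \<in> E" "(c, y) \<in> E"
      "(y, b) \<notin> E" "(b, y) \<notin> E" "(a, c) \<notin> E" "(c, a) \<notin> E"
      by (auto simp: square_at_def)
    \<comment> \<open>All four vertices lie in \<open>X\<close>, so a diagonal missing from
      \<open>E\<close> is missing from \<open>D\<close> too.\<close>
    then have "\<exists>p. type2_walk D u p w" if "u \<in> X" for u
      using type2_walk_via_square[OF assms(1) _ _ _ _ _ _ _ _ uy[OF that] dom[OF abc(1)]]
      by (auto simp: E_def)
    then show ?thesis by blast
  qed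
  then show "(\<forall>u \<in> verts (digraph_seq D (sink_elim_index D)). \<exists>p. type1_walk D u p w) \<or>
    (\<forall>u \<in> verts (digraph_seq D (sink_elim_index D)). \<exists>p. type2_walk D u p w)"
    by (simp add: X_def k_def)
qed

end
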